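(* There exists a consistent abstract provability structure $S$ satisfying the following two conditions: (1) $\mathsf{E}_S(\triangle)$ holds for every one-variable APS term $\triangle v$ of degree three. (2) For every one-variable APS term $\triangle v$ of odd degree, $\triangle\top$ is refutable in $S$.
   Context: An abstract provability structure (APS) is a tuple $S=\langle L,\leq,\top,\bot,\Box,\boxtimes\rangle$ where $L$ is a nonempty set, $\leq$ is a partial order on $L$, $\top,\bot\in L$, and $\Box,\boxtimes$ are unary operations on $L$ such that for all $x,y\in L$: (C1) if $x\leq y$ then $\Box x\leq\Box y$ and $\boxtimes y\leq\boxtimes x$; (C2) $\top\leq\boxtimes\bot$; (C3) if $x\leq\Box y$ and $x\leq\boxtimes y$ then $x\leq\boxtimes\top$; (C4) $\boxtimes x\leq\Box\boxtimes x$; (C5) $x\leq\top$. (It is not assumed that $\bot$ is the least element.) $S$ is consistent if $\top\not\leq\bot$. An element $x\in L$ is refutable in $S$ if $x\leq\bot$. A one-variable APS term $\triangle v$ is generated from the variable $v$ by finitely many applications of $\Box$ and $\boxtimes$; it induces a unary operation $x\mapsto\triangle x$ on $L$. The degree $d(\triangle)$ is the number of occurrences of $\boxtimes$ in $\triangle$. $\mathsf{E}_S(\triangle)$ means "$\triangle v$ has a fixed point in $S$", i.e. there is $p\in L$ with $\triangle p=p$. *)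

theory Defs
  imports Main
begin

record 'a aps_struct =
  carrier :: "'a set"
  leq :: "('a \<times> 'a) set"
  top_el :: 'a
  bot_el :: 'a
  Box :: "'a \<Rightarrow> 'a"
  XBox :: "'a \<Rightarrow> 'a"

abbreviation le_in :: "'a \<Rightarrow> ('a, 'm) aps_struct_scheme \<Rightarrow> 'a \<Rightarrow> bool"
    ("(_ \<sqsubseteq>\<^bsub>_\<^esub> _)" [51, 0, 51] 50) where
  "x \<sqsubseteq>\<^bsub>S\<^esub> y \<equiv> (x, y) \<in> leq S"

text \<open>\<open>Box\<close> and \<open>XBox\<close> are the operations written with a plain box and with a crossed box.
  The element \<open>bot_el\<close> is not required to be the least element.\<close>

locale aps =
  fixes S :: "('a, 'm) aps_struct_scheme" (structure)
  assumes partial_order: "partial_order_on (carrier S) (leq S)"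
    and top_closed: "top_el S \<in> carrier S"
    and bot_closed: "bot_el S \<in> carrier S"
    and Box_closed: "x \<in> carrier S \<Longrightarrow> Box S x \<in> carrier S"
    and XBox_closed: "x \<in> carrier S \<Longrightarrow> XBox S x \<in> carrier S"
    and C1_Box: "\<lbrakk>x \<in> carrier S; y \<in> carrier S; x \<sqsubseteq>\<^bsub>S\<^esub> y\<rbrakk> \<Longrightarrow> Box S x \<sqsubseteq>\<^bsub>S\<^esub> Box S y"
    and C1_XBox: "\<lbrakk>x \<in> carrier S; y \<in> carrier S; x \<sqsubseteq>\<^bsub>S\<^esub> y\<rbrakk> \<Longrightarrow> XBox S y \<sqsubseteq>\<^bsub>S\<^esub> XBox S x"
    and C2: "top_el S \<sqsubseteq>\<^bsub>S\<^esub> XBox S (bot_el S)"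
    and C3: "\<lbrakk>x \<in> carrier S; y \<in> carrier S; x \<sqsubseteq>\<^bsub>S\<^esub> Box S y; x \<sqsubseteq>\<^bsub>S\<^esub> XBox S y\<rbrakk>
      \<Longrightarrow> x \<sqsubseteq>\<^bsub>S\<^esub> XBox S (top_el S)"
    and C4: "x \<in> carrier S \<Longrightarrow> XBox S x \<sqsubseteq>\<^bsub>S\<^esub> Box S (XBox S x)"
    and C5: "x \<in> carrier S \<Longrightarrow> x \<sqsubseteq>\<^bsub>S\<^esub> top_el S"

definition consistent :: "('a, 'm) aps_struct_scheme \<Rightarrow> bool" where
  "consistent S \<longleftrightarrow> \<not> top_el S \<sqsubseteq>\<^bsub>S\<^esub> bot_el S"

definition refutable :: "('a, 'm) aps_struct_scheme \<Rightarrow> 'a \<Rightarrow> bool" where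
  "refutable S x \<longleftrightarrow> x \<in> carrier S \<and> x \<sqsubseteq>\<^bsub>S\<^esub> bot_el S"

datatype aps_term = V | TBox aps_term | TXBox aps_term

primrec interp :: "('a, 'm) aps_struct_scheme \<Rightarrow> aps_term \<Rightarrow> 'a \<Rightarrow> 'a" where
  "interp S V x = x"
| "interp S (TBox t) x = Box S (interp S t x)"
| "interp S (TXBox t) x = XBox S (interp S t x)"

primrec degree :: "aps_term \<Rightarrow> nat" where
  "degree V = 0"
| "degree (TBox t) = degree t"
| "degree (TXBox t) = Suc (degree t)"

definition has_fixed_point :: "('a, 'm) aps_struct_scheme \<Rightarrow> aps_term \<Rightarrow> bool" where
  "has_fixed_point S t \<longleftrightarrow> (\<exists>p \<in> carrier S. interp S t p = p)"

end

(* The lattice M3 (bottom 0, top 4, pairwise incomparable atoms 1, 2, 3) with the identity as Box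
   works when XBox swaps 0 and 4 and permutes the atoms cyclically. Since Box is the identity, a
   term acts as the power of XBox given by its degree: the third power fixes the atom 1, and odd
   powers send the top to the bottom. *)
theory Submission
  imports Defs
begin

definition M3_cycle :: "nat \<Rightarrow> nat" where
  "M3_cycle x = (if x = 0 then 4 else if x = 4 then 0 else if x = 3 then 1 else Suc x)"

definition M3_aps :: "nat aps_struct" where
  "M3_aps = \<lparr>carrier = {..4},
    leq = {(x, y). x \<le> 4 \<and> y \<le> 4 \<and> (x = y \<or> x = 0 \<or> y = 4)},
    top_el = 4, bot_el = 0, Box = (\<lambda>x. x), XBox = M3_cycle\<rparr>"

text \<open>For C1, distinct comparable elements involve 0 or 4, which \<open>M3_cycle\<close>
  swaps. For C3, \<open>y\<close> and \<open>M3_cycle y\<close> always have meet 0, since no atom is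
  fixed. C4 is reflexivity.\<close>

lemma M3_aps: "aps M3_aps"
proof
  show "partial_order_on (carrier M3_aps) (leq M3_aps)"
    by (auto simp: M3_aps_def partial_order_on_def preorder_on_def refl_on_def
        intro!: transI antisymI)
qed (auto simp: M3_aps_def M3_cycle_def split: if_splits)

lemma interp_M3_aps: "interp M3_aps t x = (M3_cycle ^^ degree t) x"
  by (induction t) (simp_all add: M3_aps_def)

lemma M3_cycle_odd_top: "odd n \<Longrightarrow> (M3_cycle ^^ n) 4 = 0"
  \<comment> \<open>Steps of two preserve parity, and two applications of \<open>M3_cycle\<close>
    send 0 back to 0.\<close>
  by (induction n rule: induct_nat_012) (auto simp: M3_cycle_def)

theorem proposition6p7:
  shows "\<exists>S :: nat aps_struct. aps S \<and> consistent S \<and>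
    (\<forall>t. degree t = 3 \<longrightarrow> has_fixed_point S t) \<and>
    (\<forall>t. odd (degree t) \<longrightarrow> refutable S (interp S t (top_el S)))"
proof (intro exI[of _ M3_aps] conjI allI impI)
  show "aps M3_aps" by (fact M3_aps)
  show "consistent M3_aps" by (simp add: consistent_def M3_aps_def)
next
  fix t
  assume "degree t = 3"
  then have "interp M3_aps t 1 = 1"
    \<comment> \<open>With the exponent in successor form, the orbit 1, 2, 3, 1 is computed
      directly.\<close>
    by (simp add: interp_M3_aps M3_cycle_def numeral_3_eq_3)
  then show "has_fixed_point M3_aps t"
    by (auto simp: has_fixed_point_def M3_aps_def intro!: bexI[of _ 1])
next
  fix t
  assume "odd (degree t)"
  moreover have "top_el M3_aps = 4" by (simp add: M3_aps_def)
  ultimately have "interp M3_aps t (top_el M3_aps) = 0"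
    by (simp add: interp_M3_aps M3_cycle_odd_top)
  then show "refutable M3_aps (interp M3_aps t (top_el M3_aps))"
    by (simp add: refutable_def) (simp add: M3_aps_def)
qed

end
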